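(* Let $E:\mathbb{R}^n\to\mathbb{R}^n$ be monotone and Lipschitz continuous with constant $L>0$, and assume that $X^*=\{x\in\mathbb{R}^n: E(x)=0\}$ is nonempty. Let $\{x_\ell\}_{\ell\ge 0}$ be generated by the projection-based subspace algorithm with the exact projection rule described in the context (in either its line-search version or its fixed-step version). Then $$\sum_{\ell=0}^{\infty}\|E(x_\ell)\|^2<\infty,$$ and therefore there exists a constant $C>0$ such that, for all $\ell\ge0$, $$(\ell+1)\min_{0\le k\le\ell}\|E(x_k)\|^2\le\sum_{k=0}^{\ell}\|E(x_k)\|^2\le C;$$ that is, the best-iterate estimate $\min_{0\le k\le\ell}\|E(x_k)\|=O(\ell^{-1/2})$ holds.
   Context: Setting. $\|\cdot\|$ is the Euclidean norm on $\mathbb{R}^n$. $E:\mathbb{R}^n\to\mathbb{R}^n$ is continuous and monotone, i.e. $(E(x_1)-E(x_2))^T(x_1-x_2)\ge 0$ for all $x_1,x_2\in\mathbb{R}^n$. $P_C$ denotes the Euclidean projection onto a nonempty closed convex set $C$. Parameters: $\Delta_a\in(0,1)$, $\rho\in(0,1)$, $\gamma>1$, $\mu_{\rm init}\in(0,1]$, $\zeta\in(0,1)$, $-\infty<\beta_{\min}\le\beta_{\max}<\infty$; $L$ is the Lipschitz constant of $E$. Algorithm (exact projection rule). Given $x_0\in\mathbb{R}^n$, set $p_0=p_0^{\rm sc}=-E(x_0)$. For $\ell=0,1,2,\dots$, as long as $E(x_\ell)\ne 0$ (the algorithm stops when $E(x_\ell)=0$; if it stops at an index $\ell_*$ with $E(x_{\ell_*})=0$,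 the sequence is extended by $x_\ell:=x_{\ell_*}$ for $\ell\ge\ell_*$): (1) Step size. One of two versions is used throughout. Line-search version: $\mu_\ell$ is the first trial value $\mu$, starting from $\mu=\mu_{\rm init}$ and updated after each rejection by $\mu\leftarrow\max\{\mu/\gamma,\mu_{\min}\}$, such that $(p_\ell^{\rm sc})^TE(x_\ell+\mu p_\ell^{\rm sc})\le-\rho\,\mu\|p_\ell^{\rm sc}\|^2$; here $0<\mu_{\min}\le\min\{\mu_{\rm init},\Delta_a/(L+\rho)\}$. Fixed-step version: $\mu_\ell=\alpha$ for all $\ell$, where $0<\alpha\le\min\{1,\Delta_a/(L+\rho)\}$. In both versions set $\bar x_\ell=x_\ell+\mu_\ell p_\ell^{\rm sc}$. (2) Projection. Set $x_{\ell+1}=P_{\overline H_\ell}(x_\ell)$ with $\overline H_\ell=\{x:(x-\bar x_\ell)^TE(\bar x_\ell)\le 0\}$; equivalently $x_{\ell+1}=x_\ell-\lambda_\ell E(\bar x_\ell)$ with $\lambda_\ell=(x_\ell-\bar x_\ell)^TE(\bar x_\ell)/\|E(\bar x_\ell)\|^2$. (3) Direction. If $E(x_{\ell+1})\neq 0$, compute $p_{\ell+1}$ and $p_{\ell+1}^{\rm sc}$ by the direction rule below. Direction rule at index $\ell\ge1$. Write $E_\ell=E(x_\ell)$, $p=p_{\ell-1}$ (the unscaled, angle-safeguarded previous direction), $s=\bar x_{\ell-1}-x_{\ell-1}$, $y=E(\bar x_{\ell-1})-E(x_{\ell-1})$. First $y$ is safeguarded: if $s^Ty=0$, replace $y$ by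 $y+\varphi s$ with some $0<\varphi\le\overline\varphi$; if then $y^Tp=0$, put $u=p-\frac{s^Tp}{\|s\|^2}s$ and replace $y$ by $y+\psi\|s\|u/\|u\|$ with some $0<\psi\le\overline\psi$ ($\overline\varphi,\overline\psi>0$ constants). One of the following families, with one coefficient formula, is fixed for the whole run; every coefficient is truncated to $[\beta_{\min},\beta_{\max}]$: (a) $p_\ell=-E_\ell+\beta_\ell p$, with $\beta_\ell$ one of $\frac{\|E_\ell\|^2}{\|E_{\ell-1}\|^2}$, $\frac{y^TE_\ell}{\|E_{\ell-1}\|^2}$, $\frac{y^TE_\ell}{y^Tp}$, $\frac{\|E_\ell\|^2}{y^Tp}$, $-\frac{E_\ell^Ty}{E_{\ell-1}^Tp}$, $\frac{E_\ell^T(y-2\frac{\|y\|^2}{y^Tp}p)}{y^Tp}$, $\frac{E_\ell^T(y-0.1\,p)}{y^Tp}$; (b) $p_\ell=-E_\ell+\beta^1_\ell p+\beta^2_\ell y$, with $(\beta^1_\ell,\beta^2_\ell)$ equal to $\left(\frac{y^TE_\ell}{\|E_{\ell-1}\|^2},-\frac{p^TE_\ell}{\|E_{\ell-1}\|^2}\right)$ or $\left(\frac{y^TE_\ell}{y^Tp},-\frac{p^TE_\ell}{y^Tp}\right)$; (c) $p_\ell=-E_\ell+\beta^3_\ell y+\beta^4_\ell s$, with $\beta^3_\ell=-\frac{s^TE_\ell}{y^Ts}$, $\beta^4_\ell=c_\ell\beta^3_\ell+\frac{y^TE_\ell}{y^Ts}$, where, for $\phi=\|y\|^2/(y^Ts)$,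 $c_\ell$ is one of $1+\phi$, $1+2\phi$, $1-\min\{1,\phi\}$; (d) $p_\ell=-E_\ell+\beta_\ell p+\beta^5_\ell h_\ell$, with $\beta_\ell$ one of the coefficients in (a), $h_\ell$ an auxiliary vector with $E_\ell^Th_\ell\ne0$, $\beta^5_\ell=-\frac{(\gamma_\ell-1)\|E_\ell\|^2+\beta_\ell E_\ell^Tp}{E_\ell^Th_\ell}$, $\gamma_\ell=\max\{\varsigma_1,\min\{\varsigma_2,\bar\gamma_\ell\}\}$, $0<\varsigma_1\le1<\varsigma_2$, and, for a constant $\overline\gamma>0$ and $R=\frac{E_\ell^Tp}{\|E_{\ell-1}\|\,\|p\|}$, $\bar\gamma_\ell$ one of $1\pm\overline\gamma|\beta_\ell R|$, $1\pm\overline\gamma\beta_\ell R$, $1\pm\overline\gamma|R|$, $1\pm\overline\gamma R$. If $p_\ell=0$, set $p_\ell=-E_\ell$. Angle safeguard: if the angle condition $\frac{p_\ell^TE_\ell}{\|p_\ell\|\|E_\ell\|}\le-\Delta_a$ fails, let $\sigma_1=\|E_\ell\|^2$, $\sigma_2=\|p_\ell\|^2$, $\sigma=E_\ell^Tp_\ell$, $w=\frac{\sigma_1\sigma_2-\sigma^2}{1-\Delta_a^2}$; replace $p_\ell$ by $p_\ell-\frac{\sigma+\Delta_a\sqrt w}{\sigma_1}E_\ell$ if $w>0$ and by $-E_\ell$ if $w=0$. (The resulting $p_\ell$ satisfies the angle condition.) Scaling: $p_\ell^{\rm sc}=\frac{\operatorname{mid}\{\zeta\|E_\ell\|,\|p_\ell\|,\|E_\ell\|\}}{\|p_\ell\|}p_\ell$,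 where $\operatorname{mid}$ is the median of three numbers; hence $\zeta\|E_\ell\|\le\|p_\ell^{\rm sc}\|\le\|E_\ell\|$. *)

theory Defs
  imports "HOL-Analysis.Analysis" "HOL-Library.Landau_Symbols"
begin

definition monotone_operator :: "(real^'n \<Rightarrow> real^'n) \<Rightarrow> bool" where
  "monotone_operator E \<longleftrightarrow> (\<forall>x1 x2. (E x1 - E x2) \<bullet> (x1 - x2) \<ge> 0)"


section \<open>Parameters and variants of the algorithm\<close>

record params =
  Delta_a :: real
  rho :: real
  zeta :: real
  beta_min :: real
  beta_max :: real
  phi_bar :: real
  psi_bar :: real
  varsigma1 :: real
  varsigma2 :: real
  gamma_bar :: real

definition valid_params :: "params \<Rightarrow> bool" where
  "valid_params P \<longleftrightarrow>
     0 < Delta_a P \<and> Delta_a P < 1 \<and>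
     0 < rho P \<and> rho P < 1 \<and>
     0 < zeta P \<and> zeta P < 1 \<and>
     beta_min P \<le> beta_max P \<and>
     0 < phi_bar P \<and> 0 < psi_bar P \<and>
     0 < varsigma1 P \<and> varsigma1 P \<le> 1 \<and> 1 < varsigma2 P \<and>
     0 < gamma_bar P"

text \<open>The arguments of \<open>Line_Search\<close> are \<open>\<mu>\<^sub>i\<^sub>n\<^sub>i\<^sub>t\<close>, \<open>\<gamma>\<close>, \<open>\<mu>\<^sub>m\<^sub>i\<^sub>n\<close>, that of \<open>Fixed_Step\<close> is \<open>\<alpha>\<close>.\<close>

datatype step_rule = Line_Search real real real | Fixed_Step real

fun valid_step :: "params \<Rightarrow> real \<Rightarrow> step_rule \<Rightarrow> bool" where
  "valid_step P L (Line_Search mu_init g mu_min) \<longleftrightarrow>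
     0 < mu_init \<and> mu_init \<le> 1 \<and> 1 < g \<and>
     0 < mu_min \<and> mu_min \<le> min mu_init (Delta_a P / (L + rho P))"
| "valid_step P L (Fixed_Step \<alpha>) \<longleftrightarrow>
     0 < \<alpha> \<and> \<alpha> \<le> min 1 (Delta_a P / (L + rho P))"

text \<open>
  Conjugate gradient coefficients: Fletcher-Reeves, Polak-Ribiere-Polyak, Hestenes-Stiefel,
  Dai-Yuan, Liu-Storey, Hager-Zhang, Dai-Liao.
\<close>

datatype cg_rule = FR | PRP | HS | DY | LS | HZ | DL

datatype three_term_rule = TT_PRP | TT_HS

datatype c_rule = C_one_plus_phi | C_one_plus_two_phi | C_one_minus_min

datatype pm = Plus | Minus

datatype gamma_rule = G_abs_beta_R pm | G_beta_R pm | G_abs_R pm | G_R pm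

datatype direction_rule =
    Family_a cg_rule
  | Family_b three_term_rule
  | Family_c c_rule
  | Family_d cg_rule gamma_rule

fun uses_aux :: "direction_rule \<Rightarrow> bool" where
  "uses_aux (Family_d b g) \<longleftrightarrow> True"
| "uses_aux _ \<longleftrightarrow> False"


section \<open>Step size\<close>

primrec trial :: "real \<Rightarrow> real \<Rightarrow> real \<Rightarrow> nat \<Rightarrow> real" where
  "trial mu_init g mu_min 0 = mu_init"
| "trial mu_init g mu_min (Suc k) = max (trial mu_init g mu_min k / g) mu_min"

definition accepted ::
  "params \<Rightarrow> (real^'n \<Rightarrow> real^'n) \<Rightarrow> real^'n \<Rightarrow> real^'n \<Rightarrow> real \<Rightarrow> bool" where
  "accepted P E x d \<mu> \<longleftrightarrow> d \<bullet> E (x + \<mu> *\<^sub>R d) \<le> - rho P * \<mu> * (norm d)\<^sup>2"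

text \<open>
  Finite termination of the line search is not built in: if no trial value were accepted,
  nothing would be known about the \<open>LEAST\<close> below.
\<close>

fun step_size ::
  "params \<Rightarrow> step_rule \<Rightarrow> (real^'n \<Rightarrow> real^'n) \<Rightarrow> real^'n \<Rightarrow> real^'n \<Rightarrow> real" where
  "step_size P (Line_Search mu_init g mu_min) E x d =
     trial mu_init g mu_min (LEAST k. accepted P E x d (trial mu_init g mu_min k))"
| "step_size P (Fixed_Step \<alpha>) E x d = \<alpha>"


section \<open>Directions\<close>

text \<open>
  In this section \<open>e\<close> is the value of \<open>E\<close> at the current iterate and \<open>e'\<close> that at the previous
  one; \<open>p\<close>, \<open>s\<close>, \<open>y\<close> belong to the previous iteration.
\<close>

definition trunc :: "params \<Rightarrow> real \<Rightarrow> real" where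
  "trunc P b = max (beta_min P) (min (beta_max P) b)"

text \<open>
  Along the algorithm \<open>s\<close> is a nonzero multiple of \<open>p\<close>, so \<open>y1 \<bullet> s \<noteq> 0\<close> forces \<open>y1 \<bullet> p \<noteq> 0\<close>:
  the second correction, where \<open>u\<close> would be \<open>0\<close>, is never triggered.
\<close>

definition safe_y :: "real \<Rightarrow> real \<Rightarrow> real^'n \<Rightarrow> real^'n \<Rightarrow> real^'n \<Rightarrow> real^'n" where
  "safe_y \<phi> \<psi> p s y =
     (let y1 = (if s \<bullet> y = 0 then y + \<phi> *\<^sub>R s else y);
          u = p - ((s \<bullet> p) / (norm s)\<^sup>2) *\<^sub>R s
      in if y1 \<bullet> p = 0 then y1 + (\<psi> * norm s / norm u) *\<^sub>R u else y1)"

fun cg_coeff ::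
  "cg_rule \<Rightarrow> real^'n \<Rightarrow> real^'n \<Rightarrow> real^'n \<Rightarrow> real^'n \<Rightarrow> real" where
  "cg_coeff FR e e' p y = (norm e)\<^sup>2 / (norm e')\<^sup>2"
| "cg_coeff PRP e e' p y = (y \<bullet> e) / (norm e')\<^sup>2"
| "cg_coeff HS e e' p y = (y \<bullet> e) / (y \<bullet> p)"
| "cg_coeff DY e e' p y = (norm e)\<^sup>2 / (y \<bullet> p)"
| "cg_coeff LS e e' p y = - (e \<bullet> y) / (e' \<bullet> p)"
| "cg_coeff HZ e e' p y = (e \<bullet> (y - (2 * (norm y)\<^sup>2 / (y \<bullet> p)) *\<^sub>R p)) / (y \<bullet> p)"
| "cg_coeff DL e e' p y = (e \<bullet> (y - (1/10) *\<^sub>R p)) / (y \<bullet> p)"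

fun three_term_coeffs ::
  "three_term_rule \<Rightarrow> real^'n \<Rightarrow> real^'n \<Rightarrow> real^'n \<Rightarrow> real^'n \<Rightarrow> real \<times> real" where
  "three_term_coeffs TT_PRP e e' p y =
     ((y \<bullet> e) / (norm e')\<^sup>2, - (p \<bullet> e) / (norm e')\<^sup>2)"
| "three_term_coeffs TT_HS e e' p y = ((y \<bullet> e) / (y \<bullet> p), - (p \<bullet> e) / (y \<bullet> p))"

fun c_coeff :: "c_rule \<Rightarrow> real \<Rightarrow> real" where
  "c_coeff C_one_plus_phi \<phi> = 1 + \<phi>"
| "c_coeff C_one_plus_two_phi \<phi> = 1 + 2 * \<phi>"
| "c_coeff C_one_minus_min \<phi> = 1 - min 1 \<phi>"

fun pm_apply :: "pm \<Rightarrow> real \<Rightarrow> real" where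
  "pm_apply Plus t = 1 + t"
| "pm_apply Minus t = 1 - t"

fun gamma_raw :: "gamma_rule \<Rightarrow> real \<Rightarrow> real \<Rightarrow> real \<Rightarrow> real" where
  "gamma_raw (G_abs_beta_R q) gb \<beta> R = pm_apply q (gb * \<bar>\<beta> * R\<bar>)"
| "gamma_raw (G_beta_R q) gb \<beta> R = pm_apply q (gb * \<beta> * R)"
| "gamma_raw (G_abs_R q) gb \<beta> R = pm_apply q (gb * \<bar>R\<bar>)"
| "gamma_raw (G_R q) gb \<beta> R = pm_apply q (gb * R)"

text \<open>
  Every coefficient is truncated as soon as it has been computed; where it enters the formula
  of a further coefficient, the truncated value is the one that is used.
\<close>

fun raw_direction ::
  "params \<Rightarrow> direction_rule \<Rightarrow> real^'n \<Rightarrow> real^'n \<Rightarrow> real^'n \<Rightarrow> real^'n \<Rightarrow> real^'n \<Rightarrow> real^'n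
     \<Rightarrow> real^'n" where
  "raw_direction P (Family_a b) e e' p s y h =
     - e + trunc P (cg_coeff b e e' p y) *\<^sub>R p"
| "raw_direction P (Family_b t) e e' p s y h =
     (let (b1, b2) = three_term_coeffs t e e' p y
      in - e + trunc P b1 *\<^sub>R p + trunc P b2 *\<^sub>R y)"
| "raw_direction P (Family_c r) e e' p s y h =
     (let c = c_coeff r ((norm y)\<^sup>2 / (y \<bullet> s));
          b3 = trunc P (- (s \<bullet> e) / (y \<bullet> s));
          b4 = trunc P (c * b3 + (y \<bullet> e) / (y \<bullet> s))
      in - e + b3 *\<^sub>R y + b4 *\<^sub>R s)"
| "raw_direction P (Family_d b g) e e' p s y h =
     (let \<beta> = trunc P (cg_coeff b e e' p y);
          R = (e \<bullet> p) / (norm e' * norm p);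
          \<gamma> = max (varsigma1 P) (min (varsigma2 P) (gamma_raw g (gamma_bar P) \<beta> R));
          b5 = trunc P (- ((\<gamma> - 1) * (norm e)\<^sup>2 + \<beta> * (e \<bullet> p)) / (e \<bullet> h))
      in - e + \<beta> *\<^sub>R p + b5 *\<^sub>R h)"

definition angle_condition :: "params \<Rightarrow> real^'n \<Rightarrow> real^'n \<Rightarrow> bool" where
  "angle_condition P e p \<longleftrightarrow> (p \<bullet> e) / (norm p * norm e) \<le> - Delta_a P"

text \<open>By the Cauchy-Schwarz inequality \<open>w \<ge> 0\<close>, so the last case is \<open>w = 0\<close>.\<close>

definition angle_safeguard :: "params \<Rightarrow> real^'n \<Rightarrow> real^'n \<Rightarrow> real^'n" where
  "angle_safeguard P e p =
     (if angle_condition P e p then p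
      else let \<sigma>1 = (norm e)\<^sup>2; \<sigma>2 = (norm p)\<^sup>2; \<sigma> = e \<bullet> p;
               w = (\<sigma>1 * \<sigma>2 - \<sigma>\<^sup>2) / (1 - (Delta_a P)\<^sup>2)
           in if w > 0 then p - ((\<sigma> + Delta_a P * sqrt w) / \<sigma>1) *\<^sub>R e else - e)"

definition direction ::
  "params \<Rightarrow> direction_rule \<Rightarrow> real^'n \<Rightarrow> real^'n \<Rightarrow> real^'n \<Rightarrow> real^'n \<Rightarrow> real^'n \<Rightarrow> real^'n
     \<Rightarrow> real^'n" where
  "direction P D e e' p s y h =
     (let d = raw_direction P D e e' p s y h
      in angle_safeguard P e (if d = 0 then - e else d))"

definition mid :: "real \<Rightarrow> real \<Rightarrow> real \<Rightarrow> real" where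
  "mid a b c = max (min a b) (min (max a b) c)"

definition scale :: "params \<Rightarrow> real^'n \<Rightarrow> real^'n \<Rightarrow> real^'n" where
  "scale P e p = (mid (zeta P * norm e) (norm p) (norm e) / norm p) *\<^sub>R p"


section \<open>The algorithm\<close>

text \<open>
  \<open>\<phi>\<close>, \<open>\<psi>\<close> and \<open>h\<close> are the quantities that the method leaves to the user in each iteration.
  Once \<open>E (x l) = 0\<close>, only \<open>x\<close> is constrained (it stays constant).
\<close>

definition generated_by ::
  "params \<Rightarrow> step_rule \<Rightarrow> direction_rule \<Rightarrow> (real^'n \<Rightarrow> real^'n) \<Rightarrow>
   (nat \<Rightarrow> real^'n) \<Rightarrow> (nat \<Rightarrow> real^'n) \<Rightarrow> (nat \<Rightarrow> real) \<Rightarrow>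
   (nat \<Rightarrow> real^'n) \<Rightarrow> (nat \<Rightarrow> real^'n) \<Rightarrow>
   (nat \<Rightarrow> real) \<Rightarrow> (nat \<Rightarrow> real) \<Rightarrow> (nat \<Rightarrow> real^'n) \<Rightarrow> bool" where
  "generated_by P S D E x xbar \<mu> p psc \<phi> \<psi> h \<longleftrightarrow>
     p 0 = - E (x 0) \<and> psc 0 = - E (x 0) \<and>
     (\<forall>l. E (x l) = 0 \<longrightarrow> x (Suc l) = x l) \<and>
     (\<forall>l. E (x l) \<noteq> 0 \<longrightarrow>
        \<mu> l = step_size P S E (x l) (psc l) \<and>
        xbar l = x l + \<mu> l *\<^sub>R psc l \<and>
        x (Suc l) = closest_point {z. (z - xbar l) \<bullet> E (xbar l) \<le> 0} (x l)) \<and>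
     (\<forall>l. E (x l) \<noteq> 0 \<and> E (x (Suc l)) \<noteq> 0 \<longrightarrow>
        0 < \<phi> (Suc l) \<and> \<phi> (Suc l) \<le> phi_bar P \<and>
        0 < \<psi> (Suc l) \<and> \<psi> (Suc l) \<le> psi_bar P \<and>
        (uses_aux D \<longrightarrow> E (x (Suc l)) \<bullet> h (Suc l) \<noteq> 0) \<and>
        (let s = xbar l - x l;
             y = safe_y (\<phi> (Suc l)) (\<psi> (Suc l)) (p l) s (E (xbar l) - E (x l))
         in p (Suc l) = direction P D (E (x (Suc l))) (E (x l)) (p l) s y (h (Suc l))) \<and>
        psc (Suc l) = scale P (E (x (Suc l))) (p (Suc l)))"

end

theory Submission
  imports Defs
begin

text \<open>
  The angle safeguard and the scaling give all direction formulas what a convergence proof needs: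
  the scaled direction \<open>d\<close> at an iterate with residual \<open>e \<noteq> 0\<close> satisfies
  \<open>d \<bullet> e \<le> - \<Delta>\<^sub>a \<parallel>d\<parallel> \<parallel>e\<parallel>\<close> and \<open>\<zeta> \<parallel>e\<parallel> \<le> \<parallel>d\<parallel> \<le> \<parallel>e\<parallel>\<close> (\<open>safeguarded_psc\<close>).

  The angle condition together with \<open>\<parallel>d\<parallel> \<le> \<parallel>e\<parallel>\<close> and Lipschitz continuity makes the
  line-search inequality true for every step up to \<open>\<Delta>\<^sub>a / (L + \<rho>)\<close>. So the line search
  terminates, in both versions the step \<open>\<mu>\<close> lies between a positive constant and \<open>1\<close>, and the
  inequality holds for it (\<open>step_size_bounds\<close>).

  The inequality says that the current iterate \<open>x\<close> violates the constraint defining the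
  half-space by at least \<open>\<rho> \<mu>\<^sup>2 \<parallel>d\<parallel>\<^sup>2\<close>, whereas monotonicity puts every zero of \<open>E\<close> inside the
  half-space. The violation is of order \<open>\<parallel>e\<parallel>\<^sup>2\<close> and the normal \<open>E (x + \<mu> d)\<close> has length of order
  at most \<open>\<parallel>e\<parallel>\<close>, so the projection moves \<open>x\<close> by at least \<open>c \<parallel>e\<parallel>\<close> with a constant
  \<open>c > 0\<close>. As a projection it lowers the squared distance to a fixed zero by at least the square of
  its length, that is by \<open>c\<^sup>2 \<parallel>e\<parallel>\<^sup>2\<close> (\<open>projection_step_decrease\<close>). These decreases telescope,
  and their sum is at most the initial squared distance.
\<close>

section \<open>Safeguarded directions\<close>

text \<open>
  The conditions on a search direction \<open>d\<close> at a residual \<open>e\<close> on which the convergence argument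
  rests; the angle condition is stated without a quotient.
\<close>

definition safeguarded :: "params \<Rightarrow> real^'n \<Rightarrow> real^'n \<Rightarrow> bool" where
  "safeguarded P e d \<longleftrightarrow>
     d \<bullet> e \<le> - Delta_a P * norm d * norm e \<and> zeta P * norm e \<le> norm d \<and> norm d \<le> norm e"

lemma safeguarded_steepest:
  assumes "valid_params P"
  shows "safeguarded P e (- e)"
proof -
  have "Delta_a P * (norm e)\<^sup>2 \<le> (norm e)\<^sup>2" "zeta P * norm e \<le> norm e"
    using assms by (auto simp: valid_params_def intro!: mult_left_le_one_le)
  then show ?thesis
    by (simp add: safeguarded_def power2_norm_eq_inner[symmetric] power2_eq_square mult.assoc)
qed

text \<open>
  The corrected vector \<open>q = p - ((\<sigma> + \<Delta>\<^sub>a \<surd>w) / \<sigma>\<^sub>1) e\<close> keeps the component of \<open>p\<close> orthogonal to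
  \<open>e\<close> and gets the component along \<open>e\<close> for which the angle condition is an equality:
  \<open>q \<bullet> e = - \<Delta>\<^sub>a \<surd>w\<close> and \<open>\<parallel>q\<parallel> \<parallel>e\<parallel> = \<surd>w\<close>.
\<close>

lemma angle_safeguard_angle:
  fixes e d :: "real^'n"
  assumes P: "valid_params P" and e: "e \<noteq> 0" and d: "d \<noteq> 0"
  defines "q \<equiv> angle_safeguard P e d"
  shows "q \<noteq> 0" and "q \<bullet> e \<le> - Delta_a P * norm q * norm e"
proof -
  define D where "D = Delta_a P"
  have D: "0 < D" "D < 1" "D\<^sup>2 < 1"
    using P by (auto simp: valid_params_def D_def abs_square_less_1)
  have "q \<noteq> 0 \<and> q \<bullet> e \<le> - Delta_a P * norm q * norm e"
  proof (cases "angle_condition P e d")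
    case True
    then show ?thesis
      using d e by (simp add: q_def angle_safeguard_def angle_condition_def divide_simps mult.assoc)
  next
    case False
    define w where "w = ((norm e)\<^sup>2 * (norm d)\<^sup>2 - (e \<bullet> d)\<^sup>2) / (1 - D\<^sup>2)"
    show ?thesis
    proof (cases "w > 0")
      case True
      define t where "t = (e \<bullet> d + D * sqrt w) / (norm e)\<^sup>2"
      have q: "q = d - t *\<^sub>R e"
        using False True by (simp add: q_def angle_safeguard_def Let_def w_def t_def D_def)
      have t: "t * (norm e)\<^sup>2 = e \<bullet> d + D * sqrt w"
        using e by (simp add: t_def)
      have qe: "q \<bullet> e = - D * sqrt w"
        using t by (simp add: q inner_diff_left power2_norm_eq_inner inner_commute[of e d])
      have q2: "(norm q)\<^sup>2 = (norm d)\<^sup>2 - 2 * t * (e \<bullet> d) + t\<^sup>2 * (norm e)\<^sup>2"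
        unfolding q power2_norm_eq_inner
        by (simp add: inner_diff_left inner_diff_right inner_commute[of d e] power2_eq_square
            right_diff_distrib)
      have "(norm q)\<^sup>2 * (norm e)\<^sup>2
          = (norm e)\<^sup>2 * (norm d)\<^sup>2 - 2 * (t * (norm e)\<^sup>2) * (e \<bullet> d) + (t * (norm e)\<^sup>2)\<^sup>2"
        unfolding q2 by algebra
      also have "\<dots> = (norm e)\<^sup>2 * (norm d)\<^sup>2 - (e \<bullet> d)\<^sup>2 + D\<^sup>2 * (sqrt w)\<^sup>2"
        unfolding t by algebra
      also have "\<dots> = (1 - D\<^sup>2) * w + D\<^sup>2 * w"
        using D True by (simp add: w_def)
      finally have "(norm q * norm e)\<^sup>2 = w"
        by (simp add: power_mult_distrib algebra_simps)
      then have "norm q * norm e = sqrt w"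
        by (metis norm_ge_zero mult_nonneg_nonneg real_sqrt_unique)
      then show ?thesis
        using qe True by (auto simp: D_def mult.assoc)
    next
      case w: False
      then have "q = - e"
        using False by (simp add: q_def angle_safeguard_def Let_def w_def D_def)
      then show ?thesis
        using safeguarded_steepest[OF P, of e] e by (simp add: safeguarded_def)
    qed
  qed
  then show "q \<noteq> 0" and "q \<bullet> e \<le> - Delta_a P * norm q * norm e"
    by auto
qed

lemma safeguarded_scale:
  fixes e q :: "real^'n"
  assumes P: "valid_params P" and q: "q \<noteq> 0" and angle: "q \<bullet> e \<le> - Delta_a P * norm q * norm e"
  shows "safeguarded P e (scale P e q)"
proof -
  define m where "m = mid (zeta P * norm e) (norm q) (norm e)"
  have "zeta P * norm e \<le> norm e" "0 \<le> zeta P * norm e"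
    using P by (auto simp: valid_params_def intro!: mult_left_le_one_le)
  then have m: "zeta P * norm e \<le> m" "m \<le> norm e" "0 \<le> m"
    by (auto simp: m_def mid_def)
  have norm: "norm (scale P e q) = m"
    using q m by (simp add: scale_def m_def)
  have "scale P e q \<bullet> e = (m / norm q) * (q \<bullet> e)"
    by (simp add: scale_def m_def)
  also have "\<dots> \<le> (m / norm q) * (- Delta_a P * norm q * norm e)"
    using angle m by (intro mult_left_mono) auto
  also have "\<dots> = - Delta_a P * m * norm e"
    using q by simp
  finally show ?thesis
    using m by (simp add: safeguarded_def norm)
qed

lemma safeguarded_psc:
  fixes E :: "real^'n \<Rightarrow> real^'n"
  assumes P: "valid_params P" and gen: "generated_by P S D E x xbar \<mu> p psc \<phi> \<psi> h"
    and nz: "E (x l) \<noteq> 0"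
  shows "safeguarded P (E (x l)) (psc l)"
proof (cases l)
  case 0
  then show ?thesis
    using gen safeguarded_steepest[OF P] by (simp add: generated_by_def)
next
  case (Suc k)
  \<comment> \<open>The run stays put at a zero of \<open>E\<close>, so a nonzero residual now means one before.\<close>
  have "E (x k) \<noteq> 0"
    using gen nz Suc by (auto simp: generated_by_def)
  then obtain y s where
      p: "p l = direction P D (E (x l)) (E (x k)) (p k) s y (h l)"
      and psc: "psc l = scale P (E (x l)) (p l)"
    using gen nz Suc unfolding generated_by_def Let_def by blast
  \<comment> \<open>The replacement of a vanishing direction ensures that the safeguard gets a nonzero one.\<close>
  define r where "r = raw_direction P D (E (x l)) (E (x k)) (p k) s y (h l)"
  define d where "d = (if r = 0 then - E (x l) else r)"
  have d: "d \<noteq> 0" and "p l = angle_safeguard P (E (x l)) d"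
    using nz by (auto simp: p direction_def Let_def d_def r_def)
  then show ?thesis
    using angle_safeguard_angle[OF P nz d] safeguarded_scale[OF P] psc by simp
qed


section \<open>Step sizes\<close>

text \<open>
  Moving by \<open>\<mu> d\<close> changes \<open>d \<bullet> E\<close> by at most \<open>L \<mu> \<parallel>d\<parallel>\<^sup>2\<close>, and it starts below
  \<open>- \<Delta>\<^sub>a \<parallel>d\<parallel> \<parallel>e\<parallel> \<le> - \<Delta>\<^sub>a \<parallel>d\<parallel>\<^sup>2\<close>; here \<open>\<parallel>d\<parallel> \<le> \<parallel>e\<parallel>\<close> is essential.
\<close>

lemma accepted_short_step:
  fixes E :: "real^'n \<Rightarrow> real^'n"
  assumes P: "valid_params P" and lip: "L-lipschitz_on UNIV E" and L: "L > 0"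
    and d: "safeguarded P (E x) d"
    and \<mu>: "0 \<le> \<mu>" "\<mu> \<le> Delta_a P / (L + rho P)"
  shows "accepted P E x d \<mu>"
proof -
  have P': "0 < Delta_a P" "0 < rho P"
    using P by (auto simp: valid_params_def)
  have "norm (E (x + \<mu> *\<^sub>R d) - E x) \<le> L * (\<mu> * norm d)"
    using lipschitz_onD[OF lip, of "x + \<mu> *\<^sub>R d" x] \<mu> by (simp add: dist_norm)
  then have "norm d * norm (E (x + \<mu> *\<^sub>R d) - E x) \<le> norm d * (L * (\<mu> * norm d))"
    by (intro mult_left_mono) auto
  then have change: "d \<bullet> (E (x + \<mu> *\<^sub>R d) - E x) \<le> L * \<mu> * (norm d)\<^sup>2"
    using norm_cauchy_schwarz[of d "E (x + \<mu> *\<^sub>R d) - E x"]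
    by (simp add: power2_eq_square mult_ac)
  have "Delta_a P * norm d * norm d \<le> Delta_a P * norm d * norm (E x)"
    using d P' by (intro mult_left_mono) (auto simp: safeguarded_def)
  then have start: "d \<bullet> E x \<le> - Delta_a P * (norm d)\<^sup>2"
    using d by (simp add: safeguarded_def power2_eq_square)
  have "\<mu> * (L + rho P) \<le> Delta_a P"
    using \<mu> L P' by (simp add: pos_le_divide_eq)
  then have "\<mu> * (L + rho P) * (norm d)\<^sup>2 \<le> Delta_a P * (norm d)\<^sup>2"
    by (intro mult_right_mono) auto
  then show ?thesis
    using change start by (simp add: accepted_def inner_diff_right algebra_simps)
qed

lemma trial_bounds:
  assumes "mu_min \<le> mu_init" "1 < g" "0 < mu_min"
  shows "mu_min \<le> trial mu_init g mu_min k \<and> trial mu_init g mu_min k \<le> mu_init"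
proof (induction k)
  case (Suc k)
  have "trial mu_init g mu_min k / g \<le> trial mu_init g mu_min k"
    using Suc assms by (simp add: divide_le_eq)
  then show ?case
    using Suc assms by auto
qed (use assms in auto)

lemma trial_reaches_min:
  assumes "mu_min \<le> mu_init" "1 < g" "0 < mu_min"
  shows "\<exists>k. trial mu_init g mu_min k = mu_min"
proof -
  have "trial mu_init g mu_min k \<le> max (mu_init / g ^ k) mu_min" for k
  proof (induction k)
    case (Suc k)
    have "trial mu_init g mu_min k / g \<le> max (mu_init / g ^ k) mu_min / g"
      using Suc assms by (intro divide_right_mono) auto
    also have "\<dots> \<le> max (mu_init / g ^ k / g) mu_min"
    proof -
      have "mu_min / g \<le> mu_min"
        using assms by (simp add: divide_le_eq)
      then show ?thesis
        by (auto simp: max_def)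
    qed
    also have "\<dots> = max (mu_init / g ^ Suc k) mu_min"
      by (simp add: mult.commute)
    finally show ?case
      by simp
  qed simp
  moreover obtain k where "mu_init / mu_min < g ^ k"
    using real_arch_pow[OF \<open>1 < g\<close>] by blast
  then have "mu_init / g ^ k \<le> mu_min"
    using assms by (simp add: divide_simps mult_ac)
  ultimately have "trial mu_init g mu_min k \<le> mu_min"
    by (metis max.absorb2)
  then show ?thesis
    using trial_bounds[OF assms, of k] by (intro exI[of _ k]) auto
qed

fun least_step :: "step_rule \<Rightarrow> real" where
  "least_step (Line_Search mu_init g mu_min) = mu_min"
| "least_step (Fixed_Step \<alpha>) = \<alpha>"

lemma least_step_pos: "valid_step P L S \<Longrightarrow> 0 < least_step S"
  by (cases S) auto

lemma step_size_bounds: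
  fixes E :: "real^'n \<Rightarrow> real^'n"
  assumes P: "valid_params P" and S: "valid_step P L S"
    and lip: "L-lipschitz_on UNIV E" and L: "L > 0" and d: "safeguarded P (E x) d"
  shows "least_step S \<le> step_size P S E x d" "step_size P S E x d \<le> 1"
    and "accepted P E x d (step_size P S E x d)"
proof -
  note short = accepted_short_step[OF P lip L d]
  have "least_step S \<le> step_size P S E x d \<and> step_size P S E x d \<le> 1
      \<and> accepted P E x d (step_size P S E x d)"
  proof (cases S)
    case (Line_Search mu_init g mu_min)
    with S have mu: "mu_min \<le> mu_init" "1 < g" "0 < mu_min" "mu_init \<le> 1"
        "mu_min \<le> Delta_a P / (L + rho P)"
      by auto
    \<comment> \<open>The search ends at the latest when the trial value has come down to its floor.\<close>
    obtain k where "trial mu_init g mu_min k = mu_min"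
      using trial_reaches_min mu by blast
    then have "accepted P E x d (trial mu_init g mu_min k)"
      using short mu by simp
    then have "accepted P E x d (step_size P S E x d)"
      using LeastI[of "\<lambda>k. accepted P E x d (trial mu_init g mu_min k)"]
      by (simp add: Line_Search)
    then show ?thesis
      using trial_bounds[OF mu(1-3)] mu(4) order_trans by (auto simp: Line_Search)
  next
    case (Fixed_Step \<alpha>)
    then show ?thesis
      using S short by simp
  qed
  then show "least_step S \<le> step_size P S E x d" "step_size P S E x d \<le> 1"
    and "accepted P E x d (step_size P S E x d)"
    by auto
qed


section \<open>Decrease of the distance to a zero\<close>

text \<open>
  The projection lies in the half-space, so it makes up for the whole violation of the constraint.
  By the Cauchy-Schwarz inequality this bounds the length of the step from below without an explicit
  formula for the projection.
\<close>

lemma halfspace_projection: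
  fixes x a v z :: "'a::euclidean_space"
  defines "x' \<equiv> closest_point {z. (z - a) \<bullet> v \<le> 0} x"
  assumes z: "(z - a) \<bullet> v \<le> 0"
  shows "(norm (x' - z))\<^sup>2 \<le> (norm (x - z))\<^sup>2 - (norm (x - x'))\<^sup>2"
    and "(x - a) \<bullet> v \<le> norm (x - x') * norm v"
proof -
  let ?H = "{z. (z - a) \<bullet> v \<le> 0}"
  have H: "?H = {z. v \<bullet> z \<le> v \<bullet> a}"
    by (simp add: inner_diff_left inner_commute[of v])
  have conv: "convex ?H" "closed ?H"
    unfolding H by (rule convex_halfspace_le closed_halfspace_le)+
  have "(x - x') \<bullet> (z - x') \<le> 0"
    unfolding x'_def using conv z by (intro closest_point_dot) auto
  moreover have "(norm (x - z))\<^sup>2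
      = (norm (x - x'))\<^sup>2 + (norm (x' - z))\<^sup>2 - 2 * ((x - x') \<bullet> (z - x'))"
    by (simp add: power2_norm_eq_inner inner_diff_left inner_diff_right inner_commute)
  ultimately show "(norm (x' - z))\<^sup>2 \<le> (norm (x - z))\<^sup>2 - (norm (x - x'))\<^sup>2"
    by linarith
  have "x' \<in> ?H"
    unfolding x'_def using conv z by (intro closest_point_in_set) auto
  then have "(x - a) \<bullet> v \<le> (x - x') \<bullet> v"
    by (simp add: inner_diff_left)
  also have "\<dots> \<le> norm (x - x') * norm v"
    by (rule norm_cauchy_schwarz)
  finally show "(x - a) \<bullet> v \<le> norm (x - x') * norm v" .
qed

text \<open>
  The violation of the constraint at \<open>x\<close> is at least \<open>\<rho> m\<^sup>2 \<zeta>\<^sup>2 \<parallel>E x\<parallel>\<^sup>2\<close>, and \<open>\<mu> \<le> 1\<close> and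
  \<open>\<parallel>d\<parallel> \<le> \<parallel>E x\<parallel>\<close> bound the length of the normal by \<open>(1 + L) \<parallel>E x\<parallel>\<close>. The quotient of the two
  gives the constant. In the application \<open>m\<close> is the uniform lower bound on the steps.
\<close>

lemma projection_step_decrease:
  fixes E :: "real^'n \<Rightarrow> real^'n"
  assumes P: "valid_params P" and mono: "monotone_operator E"
    and lip: "L-lipschitz_on UNIV E" and L: "L > 0"
    and z: "E z = 0" and nz: "E x \<noteq> 0" and d: "safeguarded P (E x) d"
    and \<mu>: "0 < m" "m \<le> \<mu>" "\<mu> \<le> 1" and acc: "accepted P E x d \<mu>"
  defines "a \<equiv> x + \<mu> *\<^sub>R d"
  defines "x' \<equiv> closest_point {y. (y - a) \<bullet> E a \<le> 0} x"
  shows "(rho P * m\<^sup>2 * (zeta P)\<^sup>2 / (1 + L))\<^sup>2 * (norm (E x))\<^sup>2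
      \<le> (norm (x - z))\<^sup>2 - (norm (x' - z))\<^sup>2"
proof -
  define k where "k = rho P * m\<^sup>2 * (zeta P)\<^sup>2"
  have P': "0 < rho P" "0 < zeta P"
    using P by (auto simp: valid_params_def)
  have k: "0 < k"
    using P' \<mu> by (simp add: k_def)
  have "(z - a) \<bullet> E a \<le> 0"
    using mono[unfolded monotone_operator_def, rule_format, of a z] z
    by (simp add: inner_diff_left inner_diff_right inner_commute)
  note proj = halfspace_projection[OF this, of x, folded x'_def]

  have "m\<^sup>2 * (zeta P * norm (E x))\<^sup>2 \<le> \<mu>\<^sup>2 * (norm d)\<^sup>2"
    using \<mu> d P' by (intro mult_mono power_mono) (auto simp: safeguarded_def)
  then have "rho P * (m\<^sup>2 * (zeta P * norm (E x))\<^sup>2) \<le> rho P * (\<mu>\<^sup>2 * (norm d)\<^sup>2)"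
    using P' by (intro mult_left_mono) auto
  also have "\<dots> \<le> - \<mu> * (d \<bullet> E a)"
    using mult_left_mono[OF acc[unfolded accepted_def], of \<mu>] \<mu>
    by (simp add: a_def power2_eq_square algebra_simps)
  also have "\<dots> = (x - a) \<bullet> E a"
    by (simp add: a_def)
  also have "\<dots> \<le> norm (x - x') * norm (E a)"
    by (rule proj(2))
  also have "\<dots> \<le> norm (x - x') * ((1 + L) * norm (E x))"
  proof (intro mult_left_mono)
    have "norm (E a - E x) \<le> L * (\<mu> * norm d)"
      using lipschitz_onD[OF lip, of a x] \<mu> by (simp add: dist_norm a_def)
    also have "\<dots> \<le> L * (1 * norm (E x))"
      using \<mu> L d by (intro mult_left_mono mult_mono) (auto simp: safeguarded_def)
    finally show "norm (E a) \<le> (1 + L) * norm (E x)"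
      using norm_triangle_sub[of "E a" "E x"] by (simp add: algebra_simps)
  qed auto
  finally have "(k * norm (E x)) * norm (E x) \<le> (norm (x - x') * (1 + L)) * norm (E x)"
    by (simp add: k_def power_mult_distrib power2_eq_square mult_ac)
  then have "k * norm (E x) \<le> norm (x - x') * (1 + L)"
    using nz by simp
  then have "k / (1 + L) * norm (E x) \<le> norm (x - x')"
    using L by (simp add: divide_simps mult_ac)
  then have "(k / (1 + L) * norm (E x))\<^sup>2 \<le> (norm (x - x'))\<^sup>2"
    using k L by (intro power_mono) auto
  then have "(k / (1 + L))\<^sup>2 * (norm (E x))\<^sup>2 \<le> (norm (x - x'))\<^sup>2"
    unfolding power_mult_distrib .
  then show ?thesis
    using proj(1) unfolding k_def by linarith
qed


section \<open>Summability and best iterates\<close>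

lemma summable_telescope_bound:
  fixes a b :: "nat \<Rightarrow> real"
  assumes "\<And>l. 0 \<le> a l" "\<And>l. 0 \<le> b l" "0 < c" and dec: "\<And>l. c * b l \<le> a l - a (Suc l)"
  shows "summable b"
proof (rule summableI_nonneg_bounded)
  fix n
  have "c * (\<Sum>l<n. b l) \<le> (\<Sum>l<n. a l - a (Suc l))"
    unfolding sum_distrib_left by (intro sum_mono dec)
  also have "\<dots> = a 0 - a n"
    by (rule sum_lessThan_telescope')
  also have "\<dots> \<le> a 0"
    using assms(1) by simp
  finally show "(\<Sum>l<n. b l) \<le> a 0 / c"
    using \<open>0 < c\<close> by (simp add: pos_le_divide_eq mult_ac)
qed (use assms in auto)

lemma Min_times_card_le_sum:
  fixes f :: "nat \<Rightarrow> real"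
  shows "real (l + 1) * (MIN k\<in>{0..l}. f k) \<le> (\<Sum>k=0..l. f k)"
  using sum_bounded_below[of "{0..l}" "MIN k\<in>{0..l}. f k" f] by simp

lemma best_iterate_bigo:
  fixes f :: "nat \<Rightarrow> real"
  assumes nonneg: "\<And>k. 0 \<le> f k" and bound: "\<And>l. (\<Sum>k=0..l. (f k)\<^sup>2) \<le> C"
  shows "(\<lambda>l. MIN k\<in>{0..l}. f k) \<in> O(\<lambda>l. real l powr (- 1 / 2))"
proof (rule bigoI)
  show "\<forall>\<^sub>F l in sequentially. norm (MIN k\<in>{0..l}. f k) \<le> sqrt C * norm (real l powr (- 1 / 2))"
    using eventually_gt_at_top[of 0]
  proof eventually_elim
    case (elim l)
    define M where "M = (MIN k\<in>{0..l}. f k)"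
    have M: "0 \<le> M" "\<And>k. k \<in> {0..l} \<Longrightarrow> M \<le> f k"
      using nonneg by (auto simp: M_def)
    have "real l * M\<^sup>2 \<le> real (l + 1) * M\<^sup>2"
      by (intro mult_right_mono) auto
    also have "\<dots> \<le> (\<Sum>k=0..l. (f k)\<^sup>2)"
      using sum_bounded_below[of "{0..l}" "M\<^sup>2" "\<lambda>k. (f k)\<^sup>2"] M by (auto simp: power_mono)
    also have "\<dots> \<le> C"
      by (rule bound)
    finally have "M\<^sup>2 \<le> C / real l"
      using elim by (simp add: pos_le_divide_eq mult_ac)
    then have "M \<le> sqrt C / sqrt (real l)"
      using real_le_rsqrt real_sqrt_divide by metis
    then show ?case
      using M elim by (simp add: M_def[symmetric] powr_minus_divide powr_half_sqrt)
  qed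
qed


section \<open>The convergence rate\<close>


theorem theorem3:
  fixes E :: "real^'n \<Rightarrow> real^'n"
    and L :: real
    and P :: params and S :: step_rule and D :: direction_rule
    and x xbar p psc h :: "nat \<Rightarrow> real^'n"
    and \<mu> \<phi> \<psi> :: "nat \<Rightarrow> real"
  assumes "monotone_operator E"
    and "L > 0" and "L-lipschitz_on UNIV E"
    and "{z. E z = 0} \<noteq> {}"
    and "valid_params P" and "valid_step P L S"
    and "generated_by P S D E x xbar \<mu> p psc \<phi> \<psi> h"
  shows "summable (\<lambda>l. (norm (E (x l)))\<^sup>2)
    \<and> (\<exists>C>0. \<forall>l.
          real (l + 1) * (MIN k\<in>{0..l}. (norm (E (x k)))\<^sup>2) \<le> (\<Sum>k=0..l. (norm (E (x k)))\<^sup>2)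
        \<and> (\<Sum>k=0..l. (norm (E (x k)))\<^sup>2) \<le> C)
    \<and> (\<lambda>l. MIN k\<in>{0..l}. norm (E (x k))) \<in> O(\<lambda>l. real l powr (- 1 / 2))"
proof -
  note P = \<open>valid_params P\<close> and S = \<open>valid_step P L S\<close>
    and gen = \<open>generated_by P S D E x xbar \<mu> p psc \<phi> \<psi> h\<close>
  obtain z where z: "E z = 0"
    using assms(4) by auto
  define c where "c = (rho P * (least_step S)\<^sup>2 * (zeta P)\<^sup>2 / (1 + L))\<^sup>2"
  have "c > 0"
    using P least_step_pos[OF S] \<open>L > 0\<close> by (simp add: c_def valid_params_def)
  have dec: "c * (norm (E (x l)))\<^sup>2 \<le> (norm (x l - z))\<^sup>2 - (norm (x (Suc l) - z))\<^sup>2" for l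
  proof (cases "E (x l) = 0")
    case True
    then show ?thesis
      using gen by (simp add: generated_by_def)
  next
    case False
    define m where "m = step_size P S E (x l) (psc l)"
    have x': "x (Suc l) = closest_point
        {y. (y - (x l + m *\<^sub>R psc l)) \<bullet> E (x l + m *\<^sub>R psc l) \<le> 0} (x l)"
      using gen False unfolding generated_by_def m_def by metis
    have d: "safeguarded P (E (x l)) (psc l)"
      by (rule safeguarded_psc[OF P gen False])
    note bounds = step_size_bounds[OF P S assms(3,2) d, folded m_def]
    show ?thesis
      unfolding c_def x'
      by (rule projection_step_decrease[OF P assms(1,3,2) z False d least_step_pos[OF S] bounds])
  qed
  have summ: "summable (\<lambda>l. (norm (E (x l)))\<^sup>2)"
    by (rule summable_telescope_bound[where a = "\<lambda>l. (norm (x l - z))\<^sup>2", OF _ _ \<open>c > 0\<close> dec]) auto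
  \<comment> \<open>The added \<open>1\<close> keeps the bound positive when all residuals vanish.\<close>
  define C where "C = (\<Sum>l. (norm (E (x l)))\<^sup>2) + 1"
  have C: "(\<Sum>k=0..l. (norm (E (x k)))\<^sup>2) \<le> C" for l
    using sum_le_suminf[OF summ, of "{0..l}"] by (simp add: C_def)
  have "C > 0"
    using suminf_nonneg[OF summ] by (simp add: C_def)
  then show ?thesis
    using summ C Min_times_card_le_sum best_iterate_bigo[of "\<lambda>k. norm (E (x k))", OF _ C]
    by auto
qed

end
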